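(* Let $\mu$ be a compactly supported probability measure on $\mathbb{R}$ and let $D_\mu:=\sup\{|x-y|: x,y\in\operatorname{supp}(\mu)\}$ be the diameter of its support. Then $\mu * L_t$ is unimodal for all $t>0$ with $t\ge (90/4)^{1/4}D_\mu^{1/2}$.
   Context: A Borel measure $\mu$ on $\mathbb{R}$ is unimodal if there exist $a\in\mathbb{R}$ and a function $f\colon\mathbb{R}\to[0,\infty)$, non-decreasing on $(-\infty,a)$ and non-increasing on $(a,\infty)$, such that $\mu(dx)=\mu(\{a\})\delta_a+f(x)\,dx$. For $t>0$, $L_t$ is the Lévy distribution (the law at time $t$ of a positive stable process with index $1/2$), with density $\frac{t}{\sqrt{2\pi}}\,\frac{e^{-t^2/(2x)}}{x^{3/2}}$ for $x>0$ and $0$ for $x\le 0$. Here $*$ is the classical convolution of probability measures on $\mathbb{R}$. *)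

theory Defs
  imports "HOL-Probability.Probability"
begin

definition measure_supp :: "'a::topological_space measure \<Rightarrow> 'a set" where
  "measure_supp M = {x. \<forall>U. open U \<longrightarrow> x \<in> U \<longrightarrow> emeasure M U > 0}"

text \<open>A function satisfying the two monotonicity conditions is automatically Borel measurable,
  so no measurability hypothesis is needed for \<open>density lborel f\<close> to be the measure
  \<open>f(x) dx\<close>. The value \<open>f a\<close> is unconstrained apart from being nonnegative.\<close>

definition unimodal :: "real measure \<Rightarrow> bool" where
  "unimodal M \<longleftrightarrow> sets M = sets borel \<and>
     (\<exists>(a::real) (f::real \<Rightarrow> real).
        (\<forall>x. 0 \<le> f x) \<and> mono_on {..<a} f \<and> antimono_on {a<..} f \<and>
        (\<forall>A \<in> sets borel. emeasure M A =
           emeasure M {a} * emeasure (return borel a) A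
           + emeasure (density lborel (\<lambda>x. ennreal (f x))) A))"

definition levy_density :: "real \<Rightarrow> real \<Rightarrow> real" where
  "levy_density t x =
     (if x > 0 then t / sqrt (2 * pi) * (exp (- (t^2) / (2 * x)) / x powr (3 / 2)) else 0)"

definition levy_distribution :: "real \<Rightarrow> real measure" where
  "levy_distribution t = density lborel (\<lambda>x. ennreal (levy_density t x))"

end

theory Submission
  imports Defs
begin

text \<open>The Levy density increases up to \<open>b = t\<^sup>2 / 3\<close>, decreases afterwards, and is concave on the
  interval of radius \<open>t\<^sup>2 sqrt (4 / 90)\<close> around \<open>b\<close>; the hypothesis on \<open>t\<close> says that this radius is at
  least the diameter \<open>D\<close> of the support. Say \<open>\<mu>\<close> lives on \<open>[m, m + D]\<close>. The density of the
  convolution is a \<open>\<mu>\<close>-average of translates of the Levy density by elements of \<open>[m, m + D]\<close>. All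
  translates increase before \<open>b + m\<close> and decrease after \<open>b + m + D\<close>, and in between all of them are
  concave, so the average inherits these properties and has a single mode in the middle interval.\<close>

section \<open>Supports and convolution with a density\<close>

text \<open>The complement is the union of all open null sets. By Lindelof, countably many of them
  already cover it.\<close>

lemma emeasure_Compl_measure_supp:
  fixes M :: "'a::second_countable_topology measure"
  assumes [measurable_cong]: "sets M = sets borel"
  shows "emeasure M (- measure_supp M) = 0"
proof -
  define F where "F = {U. open U \<and> emeasure M U = 0}"
  have F: "- measure_supp M = \<Union>F"
    by (auto simp: measure_supp_def F_def not_gr_zero)
  obtain F' where F': "F' \<subseteq> F" "countable F'" "\<Union>F' = \<Union>F"
    using Lindelof[of F] by (auto simp: F_def)
  have "(\<Union>U\<in>F'. U) \<in> null_sets M"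
    using F'(1) by (intro null_sets_UN' F'(2)) (auto simp: F_def null_sets_def assms)
  with F F'(3) show ?thesis by auto
qed

text \<open>Tonelli together with translation invariance of Lebesgue measure, which replaces
  \<open>x\<close> by \<open>x - y\<close> in the inner integral.\<close>

lemma convolution_density_lborel:
  fixes M :: "real measure" and p :: "real \<Rightarrow> real"
  assumes "finite_measure M" and [measurable_cong]: "sets M = sets borel"
    and [measurable]: "p \<in> borel_measurable borel"
  shows "M \<star> density lborel (\<lambda>x. ennreal (p x)) = density lborel (\<lambda>x. \<integral>\<^sup>+y. p (x - y) \<partial>M)"
proof (rule measure_eqI)
  interpret M: finite_measure M by fact
  interpret P: pair_sigma_finite M lborel ..
  let ?N = "density lborel (\<lambda>x. ennreal (p x))"
  \<comment> \<open>Sigma-finiteness holds because the density takes only finite values.\<close>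
  interpret N: sigma_finite_measure ?N
    by (subst sigma_finite_measure.sigma_finite_iff_density_finite[OF lborel.sigma_finite_measure_axioms])
       auto
  fix A assume "A \<in> sets (M \<star> ?N)"
  then have [measurable]: "A \<in> sets borel" by simp
  have "emeasure (M \<star> ?N) A = (\<integral>\<^sup>+z. indicator A z \<partial>(M \<star> ?N))"
    by simp
  also have "\<dots> = (\<integral>\<^sup>+z. indicator A (fst z + snd z) \<partial>(M \<Otimes>\<^sub>M ?N))"
    unfolding convolution_def by (subst nn_integral_distr) (auto simp: case_prod_beta)
  also have "\<dots> = (\<integral>\<^sup>+y. \<integral>\<^sup>+x. indicator A (y + x) \<partial>?N \<partial>M)"
    by (subst N.nn_integral_fst[symmetric]) auto
  also have "\<dots> = (\<integral>\<^sup>+y. \<integral>\<^sup>+x. ennreal (p x) * indicator A (y + x) \<partial>lborel \<partial>M)"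
    by (simp add: nn_integral_density)
  also have "\<dots> = (\<integral>\<^sup>+y. \<integral>\<^sup>+x. ennreal (p (x - y)) * indicator A x \<partial>lborel \<partial>M)"
  proof (rule nn_integral_cong)
    fix y
    show "(\<integral>\<^sup>+x. ennreal (p x) * indicator A (y + x) \<partial>lborel) = (\<integral>\<^sup>+x. ennreal (p (x - y)) * indicator A x \<partial>lborel)"
      by (subst nn_integral_real_affine[where c = 1 and t = "-y"]) auto
  qed
  also have "\<dots> = (\<integral>\<^sup>+x. \<integral>\<^sup>+y. ennreal (p (x - y)) * indicator A x \<partial>M \<partial>lborel)"
    by (rule P.Fubini'[symmetric]) simp
  also have "\<dots> = (\<integral>\<^sup>+x. (\<integral>\<^sup>+y. p (x - y) \<partial>M) * indicator A x \<partial>lborel)"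
    by (simp add: nn_integral_multc)
  also have "\<dots> = emeasure (density lborel (\<lambda>x. \<integral>\<^sup>+y. p (x - y) \<partial>M)) A"
    by (simp add: emeasure_density)
  finally show "emeasure (M \<star> ?N) A = emeasure (density lborel (\<lambda>x. \<integral>\<^sup>+y. p (x - y) \<partial>M)) A" .
qed simp

section \<open>Existence of a mode\<close>

text \<open>The mode is a maximum point of \<open>g\<close> on the compact middle interval, which
  exists by continuity.\<close>

lemma mono_concave_antimono_imp_mode:
  fixes g :: "real \<Rightarrow> real"
  assumes "\<alpha> \<le> \<beta>" and mono: "mono_on {..\<alpha>} g" and anti: "antimono_on {\<beta>..} g"
    and conc: "concave_on {\<alpha>..\<beta>} g" and cont: "continuous_on {\<alpha>..\<beta>} g"
  obtains a where "mono_on {..a} g" "antimono_on {a..} g"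
proof -
  obtain a where a: "a \<in> {\<alpha>..\<beta>}" and max: "\<And>x. x \<in> {\<alpha>..\<beta>} \<Longrightarrow> g x \<le> g a"
    using continuous_attains_sup[OF _ _ cont] \<open>\<alpha> \<le> \<beta>\<close> by auto
  \<comment> \<open>Moving from \<open>x\<close> towards the maximum point \<open>a\<close> cannot
    lower \<open>g\<close>: by concavity \<open>g y\<close> is at least a weighted mean of
    \<open>g x\<close> and \<open>g a\<close>, and \<open>g x \<le> g a\<close>.\<close>
  have between: "g x \<le> g y" if x: "x \<in> {\<alpha>..\<beta>}" and y: "y \<in> closed_segment x a" for x y
  proof -
    obtain u where u: "0 \<le> u" "u \<le> 1" "y = (1 - u) *\<^sub>R x + u *\<^sub>R a"
      using y by (auto simp: closed_segment_def)
    have "g x \<le> (1 - u) * g x + u * g a"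
      using mult_left_mono[OF max[OF x] u(1)] by (simp add: algebra_simps)
    also have "\<dots> \<le> g y"
      using concave_onD[OF conc u(1,2) x a] u(3) by simp
    finally show ?thesis .
  qed
  show ?thesis
  proof (rule that)
    show "mono_on {..a} g"
    proof (rule mono_onI)
      fix x y assume xy: "x \<in> {..a}" "y \<in> {..a}" "x \<le> y"
      have left: "g u \<le> g v" if "u \<le> v" "v \<le> \<alpha>" for u v
        using mono_onD[OF mono, of u v] that by auto
      have right: "g u \<le> g v" if "\<alpha> \<le> u" "u \<le> v" "v \<le> a" for u v
        using between[of u v] that a by (auto simp: closed_segment_eq_real_ivl)
      \<comment> \<open>If \<open>\<alpha>\<close> separates the two points, the inequalities are
        chained through \<open>g \<alpha>\<close>.\<close>
      show "g x \<le> g y"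
        using left[of x y] left[of x \<alpha>] right[of \<alpha> y] right[of x y] xy
        by (cases "y \<le> \<alpha>"; cases "x \<le> \<alpha>") auto
    qed
    show "antimono_on {a..} g"
    proof (rule monotone_onI)
      fix x y assume xy: "x \<in> {a..}" "y \<in> {a..}" "x \<le> y"
      have right: "g v \<le> g u" if "u \<le> v" "\<beta> \<le> u" for u v
        using monotone_onD[OF anti, of u v] that by auto
      have left: "g v \<le> g u" if "a \<le> u" "u \<le> v" "v \<le> \<beta>" for u v
        using between[of v u] that a by (auto simp: closed_segment_eq_real_ivl)
      show "g y \<le> g x"
        using left[of x y] left[of x \<beta>] right[of \<beta> y] right[of x y] xy
        by (cases "y \<le> \<beta>"; cases "x \<le> \<beta>") auto
    qed
  qed
qed

text \<open>For \<open>x\<close> in the middle interval \<open>[b + m, b + m + D]\<close> and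
  \<open>z\<close> in \<open>[m, m + D]\<close>, the difference \<open>x - z\<close> lies within
  \<open>D\<close> of \<open>b\<close>. Hence concavity and continuity of \<open>p\<close> are
  required on radius \<open>D\<close>.\<close>

lemma unimodal_convolution_density:
  fixes M :: "real measure" and p :: "real \<Rightarrow> real" and b m D :: real
  assumes "prob_space M" and sets_M [measurable_cong]: "sets M = sets borel"
    and supp: "AE y in M. y \<in> {m..m + D}" and "0 \<le> D"
    and [measurable]: "p \<in> borel_measurable borel" and nonneg: "\<And>x. 0 \<le> p x"
    and mono: "mono_on {..b} p" and anti: "antimono_on {b..} p"
    and conc: "concave_on {b - D..b + D} p" and cont: "continuous_on {b - D..b + D} p"
  shows "unimodal (M \<star> density lborel (\<lambda>x. ennreal (p x)))"
proof -
  interpret prob_space M by fact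
  define g where "g x = (\<integral>y. p (x - y) \<partial>M)" for x
  \<comment> \<open>The constant \<open>p b\<close> dominates all translates, giving integrability
    here and dominated convergence below.\<close>
  have bound: "p x \<le> p b" for x
    using mono_onD[OF mono, of x b] monotone_onD[OF anti, of b x] by (cases "x \<le> b") auto
  have int [simp]: "integrable M (\<lambda>y. p (x - y))" for x
    by (rule integrable_const_bound[where B = "p b"]) (auto simp: nonneg bound)
  have "mono_on {..b + m} g"
  proof (rule mono_onI)
    fix x y :: real assume xy: "x \<in> {..b + m}" "y \<in> {..b + m}" "x \<le> y"
    show "g x \<le> g y" unfolding g_def
    proof (rule integral_mono_AE)
      show "AE z in M. p (x - z) \<le> p (y - z)"
        using supp by eventually_elim (use xy in \<open>auto intro!: mono_onD[OF mono]\<close>)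
    qed auto
  qed
  moreover have "antimono_on {b + m + D..} g"
  proof (rule monotone_onI)
    fix x y :: real assume xy: "x \<in> {b + m + D..}" "y \<in> {b + m + D..}" "x \<le> y"
    show "g y \<le> g x" unfolding g_def
    proof (rule integral_mono_AE)
      show "AE z in M. p (y - z) \<le> p (x - z)"
        using supp by eventually_elim (use xy in \<open>auto intro!: monotone_onD[OF anti]\<close>)
    qed auto
  qed
  moreover have "concave_on {b + m..b + m + D} g"
    unfolding concave_on_iff
  proof (intro conjI ballI allI impI)
    fix x y u v :: real
    assume xy: "x \<in> {b + m..b + m + D}" "y \<in> {b + m..b + m + D}" and uv: "0 \<le> u" "0 \<le> v" "u + v = 1"
    have "u * g x + v * g y = (\<integral>z. u * p (x - z) + v * p (y - z) \<partial>M)"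
      unfolding g_def by simp
    also have "\<dots> \<le> g (u *\<^sub>R x + v *\<^sub>R y)" unfolding g_def
    proof (rule integral_mono_AE)
      show "AE z in M. u * p (x - z) + v * p (y - z) \<le> p (u *\<^sub>R x + v *\<^sub>R y - z)"
        using supp
      proof eventually_elim
        fix z assume z: "z \<in> {m..m + D}"
        \<comment> \<open>As \<open>u + v = 1\<close>, translation by \<open>z\<close> commutes with
          the convex combination, so concavity of \<open>p\<close> applies for each
          \<open>z\<close>.\<close>
        have "u *\<^sub>R x + v *\<^sub>R y - (u + v) * z = u *\<^sub>R (x - z) + v *\<^sub>R (y - z)"
          by (simp add: algebra_simps)
        then have "u *\<^sub>R x + v *\<^sub>R y - z = u *\<^sub>R (x - z) + v *\<^sub>R (y - z)"
          using uv(3) by simp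
        with z xy uv conc show "u * p (x - z) + v * p (y - z) \<le> p (u *\<^sub>R x + v *\<^sub>R y - z)"
          unfolding concave_on_iff by auto
      qed
    qed auto
    finally show "u * g x + v * g y \<le> g (u *\<^sub>R x + v *\<^sub>R y)" .
  qed simp
  moreover have "continuous_on {b + m..b + m + D} g"
  proof (rule continuous_on_sequentiallyI)
    fix u :: "nat \<Rightarrow> real" and x
    assume u: "\<forall>n. u n \<in> {b + m..b + m + D}" "u \<longlonglongrightarrow> x" and x: "x \<in> {b + m..b + m + D}"
    show "(\<lambda>n. g (u n)) \<longlonglongrightarrow> g x" unfolding g_def
    proof (rule integral_dominated_convergence[where w = "\<lambda>_. p b"])
      show "AE z in M. (\<lambda>n. p (u n - z)) \<longlonglongrightarrow> p (x - z)"
        using supp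
      proof eventually_elim
        fix z assume z: "z \<in> {m..m + D}"
        show "(\<lambda>n. p (u n - z)) \<longlonglongrightarrow> p (x - z)"
        proof (rule continuous_on_tendsto_compose[OF cont])
          show "(\<lambda>n. u n - z) \<longlonglongrightarrow> x - z"
            by (intro tendsto_intros u)
          have "u n - z \<in> {b - D..b + D}" for n
            using u(1)[rule_format, of n] z by auto
          then show "\<forall>\<^sub>F n in sequentially. u n - z \<in> {b - D..b + D}"
            by simp
        qed (use z x in auto)
      qed
    qed (auto simp: nonneg bound)
  qed
  ultimately obtain a where a: "mono_on {..a} g" "antimono_on {a..} g"
    using mono_concave_antimono_imp_mode[of "b + m" "b + m + D" g] \<open>0 \<le> D\<close> by auto
  have "(\<integral>\<^sup>+y. p (x - y) \<partial>M) = g x" for x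
    unfolding g_def by (rule nn_integral_eq_integral) (auto simp: nonneg)
  then have eq: "M \<star> density lborel (\<lambda>x. ennreal (p x)) = density lborel (\<lambda>x. ennreal (g x))"
    by (subst convolution_density_lborel) (auto simp: sets_M intro: finite_measure_axioms)
  have [measurable]: "g \<in> borel_measurable borel"
    unfolding g_def by measurable
  \<comment> \<open>An absolutely continuous measure has no atoms, so the point mass term in
    \<open>unimodal\<close> vanishes.\<close>
  have null: "emeasure (density lborel (\<lambda>x. ennreal (g x))) {a} = 0"
    by (subst emeasure_density) (simp_all add: nn_integral_indicator_singleton)
  have "0 \<le> g x" for x
    unfolding g_def by (simp add: nonneg)
  with a null show ?thesis
    unfolding unimodal_def eq
    by (auto intro!: exI[of _ a] exI[of _ g] intro: monotone_on_subset)
qed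

section \<open>The Levy density and its first two derivatives\<close>

text \<open>With a single exponential, the derivative is the density times the derivative of the
  exponent.\<close>

lemma levy_density_pos:
  assumes "0 < x"
  shows "levy_density t x = t / sqrt (2 * pi) * exp (- t\<^sup>2 / (2 * x) - 3 / 2 * ln x)"
  using assms unfolding levy_density_def powr_def by (simp add: exp_diff)

lemma levy_density_nonneg: "0 < t \<Longrightarrow> 0 \<le> levy_density t x"
  by (simp add: levy_density_def)

lemma borel_measurable_levy_density [measurable]: "levy_density t \<in> borel_measurable borel"
  unfolding levy_density_def by measurable

lemma has_real_derivative_levy_density:
  assumes "0 < x"
  shows "(levy_density t has_real_derivative levy_density t x * ((t\<^sup>2 - 3 * x) / (2 * x\<^sup>2))) (at x)"
proof (rule has_field_derivative_transform_within_open[where S = "{0<..}"])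
  show "((\<lambda>x. t / sqrt (2 * pi) * exp (- t\<^sup>2 / (2 * x) - 3 / 2 * ln x)) has_real_derivative
      levy_density t x * ((t\<^sup>2 - 3 * x) / (2 * x\<^sup>2))) (at x)"
    unfolding levy_density_pos[OF assms]
    by (rule derivative_eq_intros refl | use assms in \<open>simp; fail\<close>)+
       (use assms in \<open>simp add: field_simps power2_eq_square\<close>)
qed (simp_all add: assms levy_density_pos)

text \<open>Writing the first derivative as \<open>p * q\<close> with \<open>p' = p * q\<close>, the
  second is \<open>p * (q\<^sup>2 + q')\<close>.\<close>

lemma has_real_derivative_levy_density':
  assumes "0 < x"
  shows "((\<lambda>x. levy_density t x * ((t\<^sup>2 - 3 * x) / (2 * x\<^sup>2))) has_real_derivative
    levy_density t x * ((15 * x\<^sup>2 - 10 * t\<^sup>2 * x + t ^ 4) / (4 * x ^ 4))) (at x)"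
proof -
  have "((\<lambda>x. (t\<^sup>2 - 3 * x) / (2 * x\<^sup>2)) has_real_derivative (3 * x - 2 * t\<^sup>2) / (2 * x ^ 3)) (at x)"
    by (rule derivative_eq_intros refl | use assms in \<open>simp; fail\<close>)+
       (use assms in \<open>simp add: divide_simps power2_eq_square power3_eq_cube; algebra\<close>)
  from DERIV_mult[OF has_real_derivative_levy_density[OF assms] this]
  show ?thesis
  proof (rule DERIV_cong)
    have "(t\<^sup>2 - 3 * x) / (2 * x\<^sup>2) * ((t\<^sup>2 - 3 * x) / (2 * x\<^sup>2)) + (3 * x - 2 * t\<^sup>2) / (2 * x ^ 3)
        = (15 * x\<^sup>2 - 10 * t\<^sup>2 * x + t ^ 4) / (4 * x ^ 4)"
      using assms by (simp add: divide_simps; algebra)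
    from this[symmetric] show "levy_density t x * ((t\<^sup>2 - 3 * x) / (2 * x\<^sup>2)) * ((t\<^sup>2 - 3 * x) / (2 * x\<^sup>2)) +
        (3 * x - 2 * t\<^sup>2) / (2 * x ^ 3) * levy_density t x =
        levy_density t x * ((15 * x\<^sup>2 - 10 * t\<^sup>2 * x + t ^ 4) / (4 * x ^ 4))"
      by (simp only: ring_distribs mult_ac)
  qed
qed

lemma mono_on_levy_density:
  assumes "0 < t"
  shows "mono_on {..t\<^sup>2 / 3} (levy_density t)"
proof (rule mono_onI)
  fix x y assume xy: "x \<in> {..t\<^sup>2 / 3}" "y \<in> {..t\<^sup>2 / 3}" "x \<le> y"
  show "levy_density t x \<le> levy_density t y"
  proof (cases "0 < x")
    case True
    show ?thesis
    proof (rule DERIV_nonneg_imp_nondecreasing[OF xy(3)])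
      fix z assume "x \<le> z" "z \<le> y"
      with True xy have z: "0 < z" "3 * z \<le> t\<^sup>2" by auto
      then have "0 \<le> levy_density t z * ((t\<^sup>2 - 3 * z) / (2 * z\<^sup>2))"
        by (simp add: levy_density_nonneg assms)
      with has_real_derivative_levy_density[OF z(1)]
      show "\<exists>d. (levy_density t has_real_derivative d) (at z) \<and> 0 \<le> d" by blast
    qed
  next
    \<comment> \<open>The density is zero at \<open>x \<le> 0\<close>, so nonnegativity at
      \<open>y\<close> suffices.\<close>
    case False
    then show ?thesis
      using levy_density_nonneg[OF assms, of y] by (simp add: levy_density_def)
  qed
qed

lemma antimono_on_levy_density:
  assumes "0 < t"
  shows "antimono_on {t\<^sup>2 / 3..} (levy_density t)"
proof (rule monotone_onI)
  fix x y assume xy: "x \<in> {t\<^sup>2 / 3..}" "y \<in> {t\<^sup>2 / 3..}" "x \<le> y"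
  have "0 < t\<^sup>2 / 3" using assms by simp
  with xy(1) have "0 < x" by (simp only: atLeast_iff)
  show "levy_density t y \<le> levy_density t x"
  proof (rule DERIV_nonpos_imp_nonincreasing[OF xy(3)])
    fix z assume "x \<le> z" "z \<le> y"
    with \<open>0 < x\<close> xy have z: "0 < z" "t\<^sup>2 \<le> 3 * z" by auto
    then have "levy_density t z * ((t\<^sup>2 - 3 * z) / (2 * z\<^sup>2)) \<le> 0"
      by (intro mult_nonneg_nonpos divide_nonpos_nonneg levy_density_nonneg assms) auto
    with has_real_derivative_levy_density[OF z(1)]
    show "\<exists>d. (levy_density t has_real_derivative d) (at z) \<and> d \<le> 0" by blast
  qed
qed

lemma continuous_on_levy_density: "continuous_on {0<..} (levy_density t)"
  using DERIV_continuous[OF has_real_derivative_levy_density]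
  by (intro continuous_at_imp_continuous_on) auto

text \<open>The second derivative has the sign of \<open>15 x\<^sup>2 - 10 t\<^sup>2 x + t\<^sup>4\<close>, whose roots are
  \<open>t\<^sup>2 / 3 \<plusminus> t\<^sup>2 sqrt (4 / 90)\<close>; this is the source of the constant \<open>90 / 4\<close>.\<close>

lemma concave_on_levy_density:
  assumes "0 < t" and "90 / 4 * D\<^sup>2 \<le> t ^ 4" and "D < t\<^sup>2 / 3"
  shows "concave_on {t\<^sup>2 / 3 - D..t\<^sup>2 / 3 + D} (levy_density t)"
  unfolding concave_on_def
proof (rule f''_ge0_imp_convex)
  fix x assume x: "x \<in> {t\<^sup>2 / 3 - D..t\<^sup>2 / 3 + D}"
  \<comment> \<open>The bound on \<open>D\<close> keeps the interval inside the positive half-line,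
    where the derivative formulas hold.\<close>
  with assms(3) have "0 < x" by simp
  show "((\<lambda>x. - levy_density t x) has_real_derivative
      - (levy_density t x * ((t\<^sup>2 - 3 * x) / (2 * x\<^sup>2)))) (at x)"
    by (intro DERIV_minus has_real_derivative_levy_density \<open>0 < x\<close>)
  show "((\<lambda>x. - (levy_density t x * ((t\<^sup>2 - 3 * x) / (2 * x\<^sup>2)))) has_real_derivative
      - (levy_density t x * ((15 * x\<^sup>2 - 10 * t\<^sup>2 * x + t ^ 4) / (4 * x ^ 4)))) (at x)"
    by (intro DERIV_minus has_real_derivative_levy_density' \<open>0 < x\<close>)
  have "(x - t\<^sup>2 / 3)\<^sup>2 \<le> D\<^sup>2"
    using x by (intro abs_le_square_iff[THEN iffD1]) auto
  \<comment> \<open>After completing the square, nonpositivity follows from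
    \<open>15 * D\<^sup>2 \<le> 2 / 3 * t ^ 4\<close>, which is the assumed bound rescaled by
    \<open>2 / 3\<close>.\<close>
  moreover have "15 * x\<^sup>2 - 10 * t\<^sup>2 * x + t ^ 4 = 15 * (x - t\<^sup>2 / 3)\<^sup>2 - 2 / 3 * t ^ 4"
    by (simp add: field_simps power2_eq_square power4_eq_xxxx)
  ultimately have "15 * x\<^sup>2 - 10 * t\<^sup>2 * x + t ^ 4 \<le> 0"
    using assms(2) by linarith
  then show "0 \<le> - (levy_density t x * ((15 * x\<^sup>2 - 10 * t\<^sup>2 * x + t ^ 4) / (4 * x ^ 4)))"
    using levy_density_nonneg[OF assms(1), of x]
    by (auto intro!: mult_nonneg_nonpos divide_nonpos_nonneg)
qed simp

section \<open>Application to the support of the given measure\<close>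

theorem theorem5p3:
  fixes \<mu> :: "real measure" and t :: real
  assumes "real_distribution \<mu>"
    and "compact (measure_supp \<mu>)"
    and "t > 0"
    and "t \<ge> (90 / 4) powr (1 / 4) * diameter (measure_supp \<mu>) powr (1 / 2)"
  shows "unimodal (\<mu> \<star> levy_distribution t)"
proof -
  interpret real_distribution \<mu> by fact
  define S where "S = measure_supp \<mu>"
  define D where "D = diameter S"
  have "compact S" "0 \<le> D"
    using assms(2) by (auto simp: S_def D_def compact_imp_bounded diameter_ge_0)
  have AE_S: "AE y in \<mu>. y \<in> S"
    using emeasure_Compl_measure_supp[of \<mu>] \<open>compact S\<close> unfolding S_def
    by (intro AE_I[of _ _ "- measure_supp \<mu>"]) (auto intro: borel_compact borel_comp)
  \<comment> \<open>A probability measure cannot be concentrated on the empty set; this allows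
    choosing the least point \<open>m\<close> of the support.\<close>
  have "S \<noteq> {}"
    using AE_S by auto
  then obtain m where m: "m \<in> S" "\<And>y. y \<in> S \<Longrightarrow> m \<le> y"
    using compact_attains_inf[OF \<open>compact S\<close>] by auto
  have "y \<in> {m..m + D}" if "y \<in> S" for y
    using m(2)[OF that] diameter_bounded_bound[OF compact_imp_bounded[OF \<open>compact S\<close>] that m(1)]
    by (auto simp: D_def dist_real_def)
  with AE_S have supp: "AE y in \<mu>. y \<in> {m..m + D}" by auto
  \<comment> \<open>The fourth power clears both roots in the hypothesis on
    \<open>t\<close>.\<close>
  have "90 / 4 * D\<^sup>2 = ((90 / 4) powr (1 / 4) * D powr (1 / 2)) ^ 4"
    using \<open>0 \<le> D\<close> by (cases "D = 0") (auto simp: power_mult_distrib powr_power)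
  also have "\<dots> \<le> t ^ 4"
    using assms(4) by (intro power_mono) (auto simp: D_def S_def)
  finally have D: "90 / 4 * D\<^sup>2 \<le> t ^ 4" .
  \<comment> \<open>Since \<open>9 < 90 / 4\<close> and \<open>t > 0\<close>, the inequality is
    strict even for \<open>D = 0\<close>. The constant 9 is chosen so that square roots give
    \<open>D < t\<^sup>2 / 3\<close>.\<close>
  have "9 * D\<^sup>2 < t ^ 4"
    using D zero_less_power[OF assms(3), of 4] zero_le_power2[of D] by linarith
  then have "D\<^sup>2 < (t\<^sup>2 / 3)\<^sup>2"
    by (simp add: power_divide)
  then have D': "D < t\<^sup>2 / 3"
    by (rule power_less_imp_less_base) simp
  show ?thesis
    unfolding levy_distribution_def
  proof (rule unimodal_convolution_density[OF prob_space_axioms _ supp \<open>0 \<le> D\<close>])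
    show "continuous_on {t\<^sup>2 / 3 - D..t\<^sup>2 / 3 + D} (levy_density t)"
      using D' by (intro continuous_on_subset[OF continuous_on_levy_density]) auto
  qed (use assms(3) D D' in \<open>auto intro: levy_density_nonneg mono_on_levy_density
        antimono_on_levy_density concave_on_levy_density\<close>)
qed

end
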